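(* Let $R$ be an associative ring with identity. If $R$ is right mininjective, satisfies the ascending chain condition on right annihilators, and its right socle $S_r$ is essential in $R_R$, then $R$ is semiprimary.
   Context: Rings are associative with identity. $R$ is right mininjective if for every minimal right ideal $I$ of $R$, every right $R$-homomorphism $I\to R$ extends to a right $R$-homomorphism $R\to R$. A right annihilator is a right ideal of the form $\mathbf{r}(X)=\{r\in R: xr=0\text{ for all }x\in X\}$ with $X\subseteq R$. $S_r$ denotes the right socle of $R$, i.e. the socle of the right module $R_R$ (the sum of all minimal right ideals). $R$ is semiprimary if $R/J$ is semisimple (artinian) and $J$ is nilpotent, where $J$ is the Jacobson radical of $R$. *)

theory Defs
  imports "HOL-Algebra.Algebra"
begin

text \<open>
  The locale \<^locale>\<open>ring\<close> is not assumed commutative and admits the zero ring, whereas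
  \<^locale>\<open>module\<close> requires a commutative ring of scalars. The right module structure of a ring
  over itself is therefore expressed through right ideals.
\<close>

definition right_ideal :: "'a set \<Rightarrow> ('a, 'b) ring_scheme \<Rightarrow> bool" where
  "right_ideal I R \<longleftrightarrow>
     additive_subgroup I R \<and> (\<forall>x\<in>I. \<forall>r\<in>carrier R. x \<otimes>\<^bsub>R\<^esub> r \<in> I)"

definition minimal_right_ideal :: "'a set \<Rightarrow> ('a, 'b) ring_scheme \<Rightarrow> bool" where
  "minimal_right_ideal I R \<longleftrightarrow>
     right_ideal I R \<and> I \<noteq> {\<zero>\<^bsub>R\<^esub>} \<and>
     (\<forall>K. right_ideal K R \<and> K \<subseteq> I \<longrightarrow> K = {\<zero>\<^bsub>R\<^esub>} \<or> K = I)"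

definition maximal_right_ideal :: "'a set \<Rightarrow> ('a, 'b) ring_scheme \<Rightarrow> bool" where
  "maximal_right_ideal M R \<longleftrightarrow>
     right_ideal M R \<and> M \<noteq> carrier R \<and>
     (\<forall>K. right_ideal K R \<and> M \<subseteq> K \<longrightarrow> K = M \<or> K = carrier R)"

definition right_hom :: "('a, 'b) ring_scheme \<Rightarrow> 'a set \<Rightarrow> ('a \<Rightarrow> 'a) set" where
  "right_hom R I = {f \<in> I \<rightarrow> carrier R.
     (\<forall>x\<in>I. \<forall>y\<in>I. f (x \<oplus>\<^bsub>R\<^esub> y) = f x \<oplus>\<^bsub>R\<^esub> f y) \<and>
     (\<forall>x\<in>I. \<forall>r\<in>carrier R. f (x \<otimes>\<^bsub>R\<^esub> r) = f x \<otimes>\<^bsub>R\<^esub> r)}"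

definition right_mininjective :: "('a, 'b) ring_scheme \<Rightarrow> bool" where
  "right_mininjective R \<longleftrightarrow>
     (\<forall>I. minimal_right_ideal I R \<longrightarrow>
       (\<forall>f\<in>right_hom R I. \<exists>g\<in>right_hom R (carrier R). \<forall>x\<in>I. g x = f x))"

definition right_ann :: "('a, 'b) ring_scheme \<Rightarrow> 'a set \<Rightarrow> 'a set" where
  "right_ann R S = {r \<in> carrier R. \<forall>x\<in>S. x \<otimes>\<^bsub>R\<^esub> r = \<zero>\<^bsub>R\<^esub>}"

definition acc_right_annihilators :: "('a, 'b) ring_scheme \<Rightarrow> bool" where
  "acc_right_annihilators R \<longleftrightarrow>
     (\<forall>A :: nat \<Rightarrow> 'a set.
        (\<forall>n. \<exists>S\<subseteq>carrier R. A n = right_ann R S) \<and> (\<forall>n. A n \<subseteq> A (Suc n)) \<longrightarrow>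
        (\<exists>N. \<forall>n\<ge>N. A n = A N))"

text \<open>
  The sum of a family of right ideals is the additive subgroup generated by its union;
  for the empty family this is the zero ideal.
\<close>

definition right_socle :: "('a, 'b) ring_scheme \<Rightarrow> 'a set" where
  "right_socle R = generate (add_monoid R) (\<Union> {I. minimal_right_ideal I R})"

definition right_essential :: "('a, 'b) ring_scheme \<Rightarrow> 'a set \<Rightarrow> bool" where
  "right_essential R S \<longleftrightarrow>
     right_ideal S R \<and>
     (\<forall>I. right_ideal I R \<and> I \<noteq> {\<zero>\<^bsub>R\<^esub>} \<longrightarrow> I \<inter> S \<noteq> {\<zero>\<^bsub>R\<^esub>})"

definition right_artinian :: "('a, 'b) ring_scheme \<Rightarrow> bool" where
  "right_artinian R \<longleftrightarrow>
     (\<forall>A :: nat \<Rightarrow> 'a set.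
        (\<forall>n. right_ideal (A n) R) \<and> (\<forall>n. A (Suc n) \<subseteq> A n) \<longrightarrow>
        (\<exists>N. \<forall>n\<ge>N. A n = A N))"

text \<open>
  A ring is semisimple if, as a right module over itself, it is the sum of its simple submodules.
  Such a ring is automatically artinian; the chain condition is nevertheless stated explicitly.
\<close>

definition semisimple_artinian :: "('a, 'b) ring_scheme \<Rightarrow> bool" where
  "semisimple_artinian R \<longleftrightarrow> right_socle R = carrier R \<and> right_artinian R"

text \<open>
  The intersection of all maximal right ideals, formed inside the carrier: in the zero ring,
  which has no maximal right ideal, the radical is the whole ring.
\<close>

definition jacobson_radical :: "('a, 'b) ring_scheme \<Rightarrow> 'a set" where
  "jacobson_radical R = {x \<in> carrier R. \<forall>M. maximal_right_ideal M R \<longrightarrow> x \<in> M}"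

text \<open>
  Powers are taken in the monoid of two-sided ideals, whose product is \<^const>\<open>ideal_prod\<close>.
\<close>

definition nilpotent_ideal :: "'a set \<Rightarrow> ('a, 'b) ring_scheme \<Rightarrow> bool" where
  "nilpotent_ideal I R \<longleftrightarrow>
     ideal I R \<and> (\<exists>n::nat. I [^]\<^bsub>ideals_set R\<^esub> n = {\<zero>\<^bsub>R\<^esub>})"

definition semiprimary :: "('a, 'b) ring_scheme \<Rightarrow> bool" where
  "semiprimary R \<longleftrightarrow>
     semisimple_artinian (R Quot jacobson_radical R) \<and>
     nilpotent_ideal (jacobson_radical R) R"

end

theory Submission
  imports Defs
begin

text \<open>
Let N be the set of all a with a k = 0 for every element k of a minimal right ideal; it is a
two-sided ideal, the left annihilator of the right socle. Everything follows from two properties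
of N: it is nilpotent, and R/N is semisimple artinian with zero Jacobson radical. A nilpotent ideal
lies in the radical, and the radical of R maps into that of R/N, so N is the radical and R is
semiprimary.

Nilpotence is the Mewborn-Winton argument (\<open>nilpotent_if_singular\<close>). Since the socle is essential,
every element of N annihilates a nonzero multiple of each nonzero a. The right annihilators of the powers
of N become stationary, say at N^n. If N^n were not zero, one could choose a with N^n a \<noteq> 0
and r(a) maximal; for b in N the annihilator r(b a) is strictly larger, so N^n b a = 0. Thus
N^(n+1) a = 0, and stationarity gives N^n a = 0, a contradiction.

Semisimplicity of B = R/N is where mininjectivity enters. If k lies in a minimal right ideal and
a k is nonzero, then k r is recovered from a k r by a homomorphism of right ideals, which is
extended to R and hence is left multiplication by some b: thus b a k = k
(\<open>mininjective_left_inverse\<close>). This has two consequences. First, l(k) is a maximal left ideal for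
k nonzero, and by the chain condition finitely many of the l(k) already intersect in N
(\<open>finite_left_annihilator\<close>); so in B zero is a finite intersection of maximal left ideals. Second,
x k \<noteq> 0 gives x r x k = x k \<noteq> 0 for some r, so B is semiprime.

In such a ring an irredundant family of maximal left ideals with zero intersection yields
idempotents u with sum 1, one for each member, and semiprimeness makes each u B a minimal
right ideal (\<open>one_eq_sum_minimal\<close>). This is the passage from left to right: it makes B a finite
sum of minimal right ideals, hence semisimple and right artinian, and the kernels
of left multiplication by the u are maximal right ideals with zero intersection.
\<close>

section \<open>Right ideals\<close>

context ring
begin

lemma right_ideal_add: "right_ideal I R \<Longrightarrow> x \<in> I \<Longrightarrow> y \<in> I \<Longrightarrow> x \<oplus> y \<in> I"
  by (simp add: right_ideal_def additive_subgroup.a_closed)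

lemma right_ideal_mult: "right_ideal I R \<Longrightarrow> x \<in> I \<Longrightarrow> r \<in> carrier R \<Longrightarrow> x \<otimes> r \<in> I"
  by (simp add: right_ideal_def)

lemma right_ideal_zero: "right_ideal I R \<Longrightarrow> \<zero> \<in> I"
  by (simp add: right_ideal_def additive_subgroup.zero_closed)

lemma right_ideal_carrier: "right_ideal I R \<Longrightarrow> x \<in> I \<Longrightarrow> x \<in> carrier R"
  using additive_subgroup.a_subset[of I R] by (auto simp: right_ideal_def)

lemma right_ideal_neg:
  assumes "right_ideal I R" "x \<in> I"
  shows "\<ominus> x \<in> I"
  using right_ideal_mult[OF assms, of "\<ominus> \<one>"] right_ideal_carrier[OF assms] by (simp add: r_minus)

lemma right_ideal_diff: "right_ideal I R \<Longrightarrow> x \<in> I \<Longrightarrow> y \<in> I \<Longrightarrow> x \<ominus> y \<in> I"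
  by (simp add: minus_eq right_ideal_add right_ideal_neg)

lemma right_idealI:
  assumes "I \<subseteq> carrier R" "\<zero> \<in> I"
    and "\<And>x y. x \<in> I \<Longrightarrow> y \<in> I \<Longrightarrow> x \<oplus> y \<in> I"
    and "\<And>x r. x \<in> I \<Longrightarrow> r \<in> carrier R \<Longrightarrow> x \<otimes> r \<in> I"
  shows "right_ideal I R"
proof -
  have neg: "\<ominus> x \<in> I" if "x \<in> I" for x
    using assms(1) assms(4)[OF that, of "\<ominus> \<one>"] that by (auto simp: r_minus)
  have "subgroup I (add_monoid R)"
    by (rule add.subgroupI) (use assms neg in \<open>auto simp: a_inv_def[symmetric]\<close>)
  then show ?thesis
    using assms(4) by (simp add: right_ideal_def additive_subgroup_def)
qed

lemma right_ideal_image: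
  assumes "right_ideal I R" "a \<in> carrier R"
  shows "right_ideal ((\<otimes>) a ` I) R"
proof (rule right_idealI)
  show "(\<otimes>) a ` I \<subseteq> carrier R"
    using assms right_ideal_carrier by auto
  show "\<zero> \<in> (\<otimes>) a ` I"
    using right_ideal_zero[OF assms(1)] assms(2) by (metis image_eqI r_null)
  fix x assume "x \<in> (\<otimes>) a ` I"
  then obtain i where i: "i \<in> I" "x = a \<otimes> i" by auto
  note ic = right_ideal_carrier[OF assms(1) i(1)]
  show "x \<otimes> r \<in> (\<otimes>) a ` I" if "r \<in> carrier R" for r
    using right_ideal_mult[OF assms(1) i(1) that] i ic assms(2) that by (auto simp: m_assoc)
  show "x \<oplus> y \<in> (\<otimes>) a ` I" if "y \<in> (\<otimes>) a ` I" for y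
  proof -
    from that obtain j where j: "j \<in> I" "y = a \<otimes> j" by auto
    have "x \<oplus> y = a \<otimes> (i \<oplus> j)"
      using i j ic right_ideal_carrier[OF assms(1) j(1)] assms(2) by (simp add: r_distr)
    then show ?thesis using right_ideal_add[OF assms(1) i(1) j(1)] by auto
  qed
qed

lemma right_ideal_whole: "right_ideal (carrier R) R"
  by (rule right_idealI) auto

lemma right_ideal_principal: "a \<in> carrier R \<Longrightarrow> right_ideal ((\<otimes>) a ` carrier R) R"
  by (rule right_ideal_image[OF right_ideal_whole])

lemma right_ideal_Int:
  assumes "right_ideal I R" "right_ideal K R"
  shows "right_ideal (I \<inter> K) R"
  using assms
  by (intro right_idealI)
     (auto intro: right_ideal_carrier right_ideal_zero right_ideal_add right_ideal_mult)

lemma right_ideal_kernel: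
  assumes "a \<in> carrier R"
  shows "right_ideal {x \<in> carrier R. a \<otimes> x = \<zero>} R"
  by (rule right_idealI) (use assms in \<open>auto simp: r_distr m_assoc[symmetric]\<close>)

section \<open>Minimal right ideals and mininjectivity\<close>

lemma minimal_right_ideal_right_ideal: "minimal_right_ideal I R \<Longrightarrow> right_ideal I R"
  by (simp add: minimal_right_ideal_def)

lemma minimal_right_ideal_principal:
  assumes "minimal_right_ideal I R" "k \<in> I" "k \<noteq> \<zero>"
  shows "I = (\<otimes>) k ` carrier R"
proof -
  note ri = minimal_right_ideal_right_ideal[OF assms(1)]
  note kc = right_ideal_carrier[OF ri assms(2)]
  have "k \<in> (\<otimes>) k ` carrier R"
    using kc by (metis image_eqI one_closed r_one)
  moreover have "(\<otimes>) k ` carrier R \<subseteq> I"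
    using right_ideal_mult[OF ri assms(2)] by auto
  ultimately show ?thesis
    using assms right_ideal_principal[OF kc] unfolding minimal_right_ideal_def by blast
qed

text \<open>
Schur's lemma for left multiplication by a: the kernel is a proper submodule of a simple module.
\<close>

lemma minimal_right_ideal_mult_inj:
  assumes "minimal_right_ideal I R" "a \<in> carrier R" "k \<in> I" "a \<otimes> k \<noteq> \<zero>" "x \<in> I" "a \<otimes> x = \<zero>"
  shows "x = \<zero>"
proof -
  note ri = minimal_right_ideal_right_ideal[OF assms(1)]
  let ?K = "I \<inter> {x \<in> carrier R. a \<otimes> x = \<zero>}"
  have "right_ideal ?K R"
    by (rule right_ideal_Int[OF ri right_ideal_kernel[OF assms(2)]])
  moreover have "?K \<noteq> I" using assms(3,4) by auto
  ultimately have "?K = {\<zero>}"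
    using assms(1) unfolding minimal_right_ideal_def by blast
  then show ?thesis using assms(5,6) right_ideal_carrier[OF ri] by blast
qed

lemma minimal_right_ideal_image:
  assumes "minimal_right_ideal I R" "a \<in> carrier R" "k \<in> I" "a \<otimes> k \<noteq> \<zero>"
  shows "minimal_right_ideal ((\<otimes>) a ` I) R"
proof -
  note ri = minimal_right_ideal_right_ideal[OF assms(1)]
  have "K = {\<zero>} \<or> K = (\<otimes>) a ` I" if K: "right_ideal K R" "K \<subseteq> (\<otimes>) a ` I" for K
  proof (cases "K = {\<zero>}")
    case False
    then obtain y where y: "y \<in> K" "y \<noteq> \<zero>" using right_ideal_zero[OF K(1)] by auto
    then obtain x where x: "x \<in> I" "y = a \<otimes> x" using K(2) by auto
    have xc: "x \<in> carrier R" "x \<noteq> \<zero>" using right_ideal_carrier[OF ri x(1)] x y(2) assms(2) by auto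
    have "(\<otimes>) a ` I \<subseteq> K"
    proof
      fix z assume "z \<in> (\<otimes>) a ` I"
      then obtain r where r: "r \<in> carrier R" "z = a \<otimes> (x \<otimes> r)"
        using minimal_right_ideal_principal[OF assms(1) x(1) xc(2)] by auto
      then have "z = y \<otimes> r" using x xc assms(2) by (simp add: m_assoc)
      then show "z \<in> K" using right_ideal_mult[OF K(1) y(1) r(1)] by simp
    qed
    then show ?thesis using K(2) by auto
  qed simp
  moreover have "(\<otimes>) a ` I \<noteq> {\<zero>}" using assms(3,4) by auto
  ultimately show ?thesis
    unfolding minimal_right_ideal_def using right_ideal_image[OF ri assms(2)] by blast
qed

text \<open>
By Schur's lemma left multiplication by a is an isomorphism from I onto a I. The extension of
its inverse to R is left multiplication by the image b of 1, and that b undoes a on I.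
\<close>

lemma mininjective_left_inverse:
  assumes "right_mininjective R" "minimal_right_ideal I R" "k \<in> I" "a \<in> carrier R" "a \<otimes> k \<noteq> \<zero>"
  shows "\<exists>b\<in>carrier R. b \<otimes> (a \<otimes> k) = k"
proof -
  note ri = minimal_right_ideal_right_ideal[OF assms(2)]
  note Ic = right_ideal_carrier[OF ri]
  have inj: "inj_on ((\<otimes>) a) I"
  proof (rule inj_onI)
    fix x y assume xy: "x \<in> I" "y \<in> I" "a \<otimes> x = a \<otimes> y"
    have "a \<otimes> (x \<ominus> y) = \<zero>"
      using xy Ic assms(4) by (simp add: minus_eq r_distr r_minus r_neg)
    then have "x \<ominus> y = \<zero>"
      using minimal_right_ideal_mult_inj[OF assms(2,4,3,5) right_ideal_diff[OF ri xy(1,2)]] by simp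
    then show "x = y" using xy Ic by (simp add: r_right_minus_eq)
  qed
  define f where "f = inv_into I ((\<otimes>) a)"
  have f: "f (a \<otimes> x) = x" if "x \<in> I" for x
    unfolding f_def using inj that by (rule inv_into_f_f)
  have "f \<in> right_hom R ((\<otimes>) a ` I)"
    unfolding right_hom_def
  proof (safe)
    fix x assume x: "x \<in> I"
    show "f (a \<otimes> x) \<in> carrier R" using x f Ic by simp
    show "f (a \<otimes> x \<oplus> a \<otimes> y) = f (a \<otimes> x) \<oplus> f (a \<otimes> y)" if y: "y \<in> I" for y
    proof -
      have "a \<otimes> x \<oplus> a \<otimes> y = a \<otimes> (x \<oplus> y)" using x y Ic assms(4) by (simp add: r_distr)
      then show ?thesis using f x y right_ideal_add[OF ri x y] by simp
    qed
    show "f (a \<otimes> x \<otimes> r) = f (a \<otimes> x) \<otimes> r" if r: "r \<in> carrier R" for r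
    proof -
      have "a \<otimes> x \<otimes> r = a \<otimes> (x \<otimes> r)" using x r Ic assms(4) by (simp add: m_assoc)
      then show ?thesis using f x r right_ideal_mult[OF ri x r] by simp
    qed
  qed
  then obtain g where g: "g \<in> right_hom R (carrier R)" "\<And>x. x \<in> (\<otimes>) a ` I \<Longrightarrow> g x = f x"
    using assms(1) minimal_right_ideal_image[OF assms(2,4,3,5)] unfolding right_mininjective_def by blast
  have gc: "g \<one> \<in> carrier R" using g(1) by (auto simp: right_hom_def)
  have akc: "a \<otimes> k \<in> carrier R" using Ic assms(3,4) by simp
  have "g \<one> \<otimes> (a \<otimes> k) = g (\<one> \<otimes> (a \<otimes> k))"
    using g(1) akc by (simp add: right_hom_def del: l_one)
  also have "\<dots> = k" using akc g(2) f assms(3) by simp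
  finally show ?thesis using gc by blast
qed

section \<open>The chain condition on right annihilators\<close>

lemma acc_right_annihilators_maximal:
  assumes "acc_right_annihilators R" "F \<noteq> {}"
    and "\<And>A. A \<in> F \<Longrightarrow> \<exists>S\<subseteq>carrier R. A = right_ann R S"
  shows "\<exists>A\<in>F. \<forall>B\<in>F. A \<subseteq> B \<longrightarrow> B = A"
proof (rule ccontr)
  assume "\<not> ?thesis"
  then have up: "\<exists>B. B \<in> F \<and> A \<subset> B" if "A \<in> F" for A using that by blast
  have "\<exists>A :: nat \<Rightarrow> 'a set. \<forall>n. A n \<in> F \<and> A n \<subset> A (Suc n)"
  proof (rule dependent_nat_choice)
    show "\<exists>A. A \<in> F" using assms(2) by auto
    show "\<exists>B. B \<in> F \<and> A \<subset> B" if "A \<in> F" for A n using up[OF that] .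
  qed
  then obtain A :: "nat \<Rightarrow> 'a set" where A: "\<And>n. A n \<in> F" "\<And>n. A n \<subset> A (Suc n)"
    by blast
  have "\<exists>N. \<forall>n\<ge>N. A n = A N"
    using assms(3)[OF A(1)] psubset_imp_subset[OF A(2)]
    by (intro assms(1)[unfolded acc_right_annihilators_def, rule_format]) auto
  then obtain N where "A (Suc N) = A N" by (meson le_Suc_eq order_refl)
  then show False using A(2)[of N] by auto
qed

lemma ideal_pow_0: "I [^]\<^bsub>ideals_set R\<^esub> (0::nat) = carrier R"
  by (simp add: nat_pow_def ideals_set_def)

lemma ideal_pow_Suc: "I [^]\<^bsub>ideals_set R\<^esub> (Suc n) = (I [^]\<^bsub>ideals_set R\<^esub> n) \<cdot> I"
  by (simp add: nat_pow_def ideals_set_def)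

lemma ideal_ideal_pow:
  assumes "ideal I R"
  shows "ideal (I [^]\<^bsub>ideals_set R\<^esub> (n::nat)) R"
proof (induction n)
  case 0
  show ?case unfolding ideal_pow_0 by (rule oneideal)
next
  case (Suc n)
  then show ?case unfolding ideal_pow_Suc by (rule ideal_prod_is_ideal[OF _ assms])
qed

lemma right_ann_ideal_prod:
  assumes "ideal I R" "ideal K R" "a \<in> carrier R"
    and "\<And>c b. c \<in> I \<Longrightarrow> b \<in> K \<Longrightarrow> c \<otimes> (b \<otimes> a) = \<zero>"
  shows "a \<in> right_ann R (I \<cdot> K)"
proof -
  have "x \<otimes> a = \<zero>" if "x \<in> I \<cdot> K" for x
    using that
  proof (induction rule: ideal_prod.induct)
    case (prod i j)
    then show ?case using assms ideal.Icarr by (metis m_assoc)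
  next
    case (sum s1 s2)
    then have "s1 \<in> carrier R" "s2 \<in> carrier R" using ideal_prod_in_carrier[OF assms(1,2)] by auto
    then show ?case using sum assms(3) by (simp add: l_distr)
  qed
  then show ?thesis using assms(3) by (simp add: right_ann_def)
qed

text \<open>
The Mewborn-Winton theorem. The hypothesis on N says that the right annihilator of each
element of N is an essential right ideal, that is, N consists of right singular elements.
\<close>

lemma nilpotent_if_singular:
  assumes acc: "acc_right_annihilators R" and N: "ideal N R"
    and sing: "\<And>b a. b \<in> N \<Longrightarrow> a \<in> carrier R \<Longrightarrow> a \<noteq> \<zero> \<Longrightarrow>
      \<exists>r\<in>carrier R. a \<otimes> r \<noteq> \<zero> \<and> b \<otimes> (a \<otimes> r) = \<zero>"
  shows "nilpotent_ideal N R"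
proof -
  define P where "P n = N [^]\<^bsub>ideals_set R\<^esub> n" for n :: nat
  have Pid: "ideal (P n) R" for n unfolding P_def by (rule ideal_ideal_pow[OF N])
  have Pc: "P n \<subseteq> carrier R" for n using ideal.Icarr[OF Pid] by auto
  have PSuc: "P (Suc n) = P n \<cdot> N" for n unfolding P_def by (rule ideal_pow_Suc)
  have "P (Suc n) \<subseteq> P n" for n using ideal_prod_inter[OF Pid N] PSuc by auto
  then have "right_ann R (P n) \<subseteq> right_ann R (P (Suc n))" for n by (auto simp: right_ann_def)
  with Pc have "\<exists>n. \<forall>m\<ge>n. right_ann R (P m) = right_ann R (P n)"
    by (intro acc[unfolded acc_right_annihilators_def, rule_format]) auto
  then obtain n where n: "right_ann R (P (Suc n)) = right_ann R (P n)"
    by (meson le_Suc_eq order_refl)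
  have "P n = {\<zero>}"
  proof (rule ccontr)
    assume nz: "P n \<noteq> {\<zero>}"
    \<comment> \<open>Choose a outside the stable annihilator with r(a) maximal; then r(b a) is strictly larger for b in N.\<close>
    define F where "F = {right_ann R {a} |a. a \<in> carrier R \<and> a \<notin> right_ann R (P n)}"
    obtain c where c: "c \<in> P n" "c \<noteq> \<zero>"
      using nz additive_subgroup.zero_closed[OF ideal.axioms(1)[OF Pid]] by auto
    then have "\<one> \<notin> right_ann R (P n)"
      using ideal.Icarr[OF Pid c(1)] by (auto simp: right_ann_def intro!: bexI[of _ c])
    then have "F \<noteq> {}" by (auto simp: F_def)
    then have "\<exists>A\<in>F. \<forall>B\<in>F. A \<subseteq> B \<longrightarrow> B = A"
      by (rule acc_right_annihilators_maximal[OF acc]) (auto simp: F_def)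
    then obtain A where A: "A \<in> F" and max: "\<And>B. B \<in> F \<Longrightarrow> A \<subseteq> B \<Longrightarrow> B = A"
      by blast
    then obtain a where a: "a \<in> carrier R" "a \<notin> right_ann R (P n)" "A = right_ann R {a}"
      unfolding F_def by auto
    have az: "a \<noteq> \<zero>" using a ideal.Icarr[OF Pid] by (auto simp: right_ann_def)
    have "b \<otimes> a \<in> right_ann R (P n)" if b: "b \<in> N" for b
    proof (rule ccontr)
      assume ba: "b \<otimes> a \<notin> right_ann R (P n)"
      have bc: "b \<in> carrier R" using ideal.Icarr[OF N b] .
      have "right_ann R {b \<otimes> a} \<in> F"
        unfolding F_def using a(1) ba bc by auto
      moreover have "right_ann R {a} \<subseteq> right_ann R {b \<otimes> a}"
        using a bc by (auto simp: right_ann_def m_assoc)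
      ultimately have eq: "right_ann R {b \<otimes> a} = right_ann R {a}" using max a(3) by simp
      obtain r where r: "r \<in> carrier R" "a \<otimes> r \<noteq> \<zero>" "b \<otimes> (a \<otimes> r) = \<zero>"
        using sing[OF b a(1) az] by blast
      then have "r \<in> right_ann R {b \<otimes> a}" using a bc by (simp add: right_ann_def m_assoc)
      moreover have "r \<notin> right_ann R {a}" using r by (simp add: right_ann_def)
      ultimately show False using eq by simp
    qed
    then have "a \<in> right_ann R (P n \<cdot> N)"
      by (intro right_ann_ideal_prod Pid N a) (simp add: right_ann_def)
    then show False using n a PSuc by simp
  qed
  then show ?thesis using N unfolding nilpotent_ideal_def P_def by blast
qed

text \<open>
The ascending chain condition on right annihilators amounts to the descending one on left
annihilators. For a finite K with r(l(K)) maximal, adding any k in S to K does not change r(l(K)),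
so k itself is in it: l(K) kills all of S.
\<close>

lemma finite_left_annihilator:
  assumes acc: "acc_right_annihilators R" and S: "S \<subseteq> carrier R"
  shows "\<exists>K. finite K \<and> K \<subseteq> S \<and>
    (\<forall>a\<in>carrier R. (\<forall>k\<in>K. a \<otimes> k = \<zero>) \<longrightarrow> (\<forall>k\<in>S. a \<otimes> k = \<zero>))"
proof -
  define l where "l K = {a \<in> carrier R. \<forall>k\<in>K. a \<otimes> k = \<zero>}" for K
  define F where "F = {right_ann R (l K) |K. finite K \<and> K \<subseteq> S}"
  have "F \<noteq> {}" by (auto simp: F_def)
  moreover have "l K \<subseteq> carrier R" for K by (auto simp: l_def)
  then have "\<exists>S\<subseteq>carrier R. A = right_ann R S" if "A \<in> F" for A
    using that unfolding F_def by auto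
  ultimately have "\<exists>A\<in>F. \<forall>B\<in>F. A \<subseteq> B \<longrightarrow> B = A"
    by (rule acc_right_annihilators_maximal[OF acc])
  then obtain A where A: "A \<in> F" and max: "\<And>B. B \<in> F \<Longrightarrow> A \<subseteq> B \<Longrightarrow> B = A"
    by blast
  then obtain K where K: "finite K" "K \<subseteq> S" "A = right_ann R (l K)"
    unfolding F_def by auto
  have "a \<otimes> k = \<zero>" if a: "a \<in> carrier R" "\<forall>k\<in>K. a \<otimes> k = \<zero>" and k: "k \<in> S" for a k
  proof -
    have "right_ann R (l (insert k K)) \<in> F"
      using K(1,2) k unfolding F_def by (intro CollectI exI[of _ "insert k K"]) simp
    moreover have "right_ann R (l K) \<subseteq> right_ann R (l (insert k K))"
      by (auto simp: right_ann_def l_def)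
    ultimately have "right_ann R (l (insert k K)) = right_ann R (l K)"
      using max K(3) by simp
    moreover have "k \<in> right_ann R (l (insert k K))"
      using k S by (auto simp: right_ann_def l_def)
    ultimately show ?thesis using a by (auto simp: right_ann_def l_def)
  qed
  then show ?thesis using K(1,2) by blast
qed

end


section \<open>Semiprime rings with finitely many maximal left ideals intersecting in zero\<close>

text \<open>
For a proper left ideal L the last condition is maximality: R a + L = R for a outside L. The
elementwise form is what the proofs produce and consume.
\<close>

definition maximal_left_ideal :: "'a set \<Rightarrow> ('a, 'b) ring_scheme \<Rightarrow> bool" where
  "maximal_left_ideal L R \<longleftrightarrow>
     additive_subgroup L R \<and> (\<forall>r\<in>carrier R. \<forall>x\<in>L. r \<otimes>\<^bsub>R\<^esub> x \<in> L) \<and> \<one>\<^bsub>R\<^esub> \<notin> L \<and>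
     (\<forall>a\<in>carrier R - L. \<exists>b\<in>carrier R. \<one>\<^bsub>R\<^esub> \<ominus>\<^bsub>R\<^esub> b \<otimes>\<^bsub>R\<^esub> a \<in> L)"

context ring
begin

lemma additive_subgroup_diff:
  assumes "additive_subgroup L R" "x \<in> L" "y \<in> L"
  shows "x \<ominus> y \<in> L"
  using assms additive_subgroup.a_closed[OF assms(1)] additive_subgroup.a_inv_closed[OF assms(1)]
  by (simp add: minus_eq)

lemma additive_subgroup_finsum:
  assumes "additive_subgroup L R" "finite A" "\<And>i. i \<in> A \<Longrightarrow> f i \<in> L"
  shows "(\<Oplus>i\<in>A. f i) \<in> L"
  using assms(2,3)
proof (induction rule: finite_induct)
  case empty
  then show ?case using additive_subgroup.zero_closed[OF assms(1)] by simp
next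
  case (insert i A)
  then have "f j \<in> carrier R" if "j \<in> insert i A" for j
    using that additive_subgroup.a_subset[OF assms(1)] by blast
  then show ?case
    using insert additive_subgroup.a_closed[OF assms(1)] by (simp add: finsum_insert Pi_def)
qed

text \<open>
The hypothesis \<open>inv\<close> makes the corner ring u R u a division ring: an element with a left inverse
in it has a two-sided one, because the left inverse is left invertible too. Semiprimeness moves
a nonzero x of u R into the corner: x b x \<noteq> 0 forces x b u \<noteq> 0, so x R contains an
invertible element of the corner, hence u.
\<close>

lemma minimal_right_ideal_idempotent:
  assumes semiprime: "\<And>x. x \<in> carrier R \<Longrightarrow> x \<noteq> \<zero> \<Longrightarrow> \<exists>b\<in>carrier R. x \<otimes> b \<otimes> x \<noteq> \<zero>"
    and u: "u \<in> carrier R" "u \<noteq> \<zero>" "u \<otimes> u = u"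
    and inv: "\<And>y. y \<in> carrier R \<Longrightarrow> u \<otimes> y \<otimes> u \<noteq> \<zero> \<Longrightarrow> \<exists>z\<in>carrier R. z \<otimes> (u \<otimes> y \<otimes> u) = u"
  shows "minimal_right_ideal ((\<otimes>) u ` carrier R) R"
proof -
  have inv': "\<exists>z\<in>carrier R. (u \<otimes> z \<otimes> u) \<otimes> (u \<otimes> y \<otimes> u) = u"
    if y: "y \<in> carrier R" "u \<otimes> y \<otimes> u \<noteq> \<zero>" for y
  proof -
    obtain z where z: "z \<in> carrier R" "z \<otimes> (u \<otimes> y \<otimes> u) = u" using inv[OF y] by blast
    have "(u \<otimes> z \<otimes> u) \<otimes> (u \<otimes> y \<otimes> u) = u \<otimes> z \<otimes> ((u \<otimes> u) \<otimes> y \<otimes> u)"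
      using u(1) z(1) y(1) by (simp only: m_assoc m_closed)
    also have "\<dots> = u \<otimes> (z \<otimes> (u \<otimes> y \<otimes> u))"
      using u z(1) y(1) by (simp only: u(3) m_assoc m_closed)
    finally show ?thesis using z u(3) by auto
  qed
  have "K = {\<zero>} \<or> K = (\<otimes>) u ` carrier R"
    if K: "right_ideal K R" "K \<subseteq> (\<otimes>) u ` carrier R" for K
  proof (cases "K = {\<zero>}")
    case False
    then obtain x where x: "x \<in> K" "x \<noteq> \<zero>" using right_ideal_zero[OF K(1)] by auto
    note xc = right_ideal_carrier[OF K(1) x(1)]
    obtain t where t: "t \<in> carrier R" "x = u \<otimes> t" using x K(2) by auto
    have ux: "u \<otimes> x = x" using t u by (simp add: m_assoc[symmetric])
    obtain b where b: "b \<in> carrier R" "x \<otimes> b \<otimes> x \<noteq> \<zero>" using semiprime[OF xc x(2)] by blast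
    \<comment> \<open>y is a nonzero element of the corner lying in x R; z inverts it on the left, and w inverts z.\<close>
    define y where "y = x \<otimes> b \<otimes> u"
    have yc: "y \<in> carrier R" using xc b u by (simp add: y_def)
    have y: "u \<otimes> (x \<otimes> b) \<otimes> u = y"
      using u(1) xc b(1) by (simp add: y_def m_assoc[symmetric] ux)
    have uy: "u \<otimes> y = y" using u(1) xc b(1) by (simp add: y_def m_assoc[symmetric] ux)
    have "y \<otimes> x = x \<otimes> b \<otimes> x" using ux u(1) xc b(1) by (simp add: y_def m_assoc)
    then have yz: "y \<noteq> \<zero>" using b(2) xc by auto
    obtain z where z: "z \<in> carrier R" "(u \<otimes> z \<otimes> u) \<otimes> y = u"
      using inv'[of "x \<otimes> b"] y yz xc b(1) by auto
    have "u \<otimes> z \<otimes> u \<noteq> \<zero>" using z(2) u yc by auto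
    then obtain w where w: "w \<in> carrier R" "(u \<otimes> w \<otimes> u) \<otimes> (u \<otimes> z \<otimes> u) = u"
      using inv'[OF z(1)] by blast
    have "u \<otimes> w \<otimes> u = (u \<otimes> w \<otimes> u) \<otimes> u" using w(1) u by (simp add: m_assoc)
    also have "\<dots> = ((u \<otimes> w \<otimes> u) \<otimes> (u \<otimes> z \<otimes> u)) \<otimes> y"
      using w(1) z u(1) yc by (simp add: m_assoc)
    also have "\<dots> = y" using w(2) uy by simp
    finally have "y \<otimes> (u \<otimes> z \<otimes> u) = u" using w(2) by simp
    moreover have "y \<in> K"
      unfolding y_def using x(1) b(1) u(1) by (intro right_ideal_mult[OF K(1)])
    ultimately have "u \<in> K"
      using right_ideal_mult[OF K(1), of y "u \<otimes> z \<otimes> u"] u(1) z(1) by simp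
    then show ?thesis using K right_ideal_mult[OF K(1)] by auto
  qed simp
  moreover have "u \<in> (\<otimes>) u ` carrier R" using u(1) by (metis image_eqI one_closed r_one)
  ultimately show ?thesis
    unfolding minimal_right_ideal_def using right_ideal_principal[OF u(1)] u(2) by blast
qed

text \<open>
Take a subfamily with zero intersection and no superfluous member. For each M in it the
intersection of the others is a nonzero left ideal not inside M, so by maximality it contains u
with 1 - u in M. Any element in that intersection and in M is zero; testing u (1 - u) and
u - u b v against this shows that u is idempotent and that u R u is a division ring. The u
add up to 1 because 1 minus their sum lies in every member of the subfamily.
\<close>

lemma one_eq_sum_minimal:
  assumes semiprime: "\<And>x. x \<in> carrier R \<Longrightarrow> x \<noteq> \<zero> \<Longrightarrow> \<exists>b\<in>carrier R. x \<otimes> b \<otimes> x \<noteq> \<zero>"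
    and fin: "finite \<M>"
    and max: "\<And>M. M \<in> \<M> \<Longrightarrow> maximal_left_ideal M R"
    and Int0: "\<And>x. x \<in> carrier R \<Longrightarrow> (\<And>M. M \<in> \<M> \<Longrightarrow> x \<in> M) \<Longrightarrow> x = \<zero>"
  shows "\<exists>(\<N> :: 'a set set) u. finite \<N> \<and> (\<Oplus>M\<in>\<N>. u M) = \<one> \<and>
    (\<forall>M\<in>\<N>. u M \<in> carrier R \<and> minimal_right_ideal ((\<otimes>) (u M) ` carrier R) R)"
proof -
  define Z where "Z \<N> \<longleftrightarrow> (\<forall>x\<in>carrier R. (\<forall>M\<in>\<N>. x \<in> M) \<longrightarrow> x = \<zero>)" for \<N>
  define \<F> where "\<F> = {\<N>. \<N> \<subseteq> \<M> \<and> Z \<N>}"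
  have "finite \<F>" using fin by (simp add: \<F>_def)
  moreover have "\<M> \<in> \<F>" using Int0 by (auto simp: \<F>_def Z_def)
  ultimately obtain \<N> where min: "\<N> \<in> \<F>" "\<And>\<N>'. \<N>' \<in> \<F> \<Longrightarrow> \<N>' \<subseteq> \<N> \<Longrightarrow> \<N> = \<N>'"
    using finite_has_minimal[of \<F>] by blast
  have N: "\<N> \<subseteq> \<M>" "Z \<N>" using min(1) by (auto simp: \<F>_def)
  have irr: "\<N> = \<N>'" if "\<N>' \<subseteq> \<M>" "Z \<N>'" "\<N>' \<subseteq> \<N>" for \<N>'
    using min(2)[of \<N>'] that by (simp add: \<F>_def)
  have Nfin: "finite \<N>" using N(1) fin finite_subset by blast
  have sub: "additive_subgroup M R" if "M \<in> \<N>" for M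
    using max N(1) that by (auto simp: maximal_left_ideal_def)
  have lmult: "r \<otimes> x \<in> M" if "M \<in> \<N>" "r \<in> carrier R" "x \<in> M" for r x M
    using max N(1) that by (auto simp: maximal_left_ideal_def)
  have comax: "\<exists>b\<in>carrier R. \<one> \<ominus> b \<otimes> a \<in> M" if "M \<in> \<N>" "a \<in> carrier R" "a \<notin> M" for a M
    using max N(1) that unfolding maximal_left_ideal_def by blast
  have zeroI: "x = \<zero>" if "x \<in> carrier R" "M \<in> \<N>" "x \<in> M" "\<And>N. N \<in> \<N> - {M} \<Longrightarrow> x \<in> N" for x M
    using N(2) that unfolding Z_def by blast
  have "\<exists>u. u \<in> carrier R \<and> \<one> \<ominus> u \<in> M \<and> (\<forall>N\<in>\<N> - {M}. u \<in> N)" if M: "M \<in> \<N>" for M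
  proof -
    have "\<not> Z (\<N> - {M})" using irr[of "\<N> - {M}"] M N(1) by blast
    then obtain a where a: "a \<in> carrier R" "a \<noteq> \<zero>" "\<And>N. N \<in> \<N> - {M} \<Longrightarrow> a \<in> N"
      unfolding Z_def by blast
    then have "a \<notin> M" using zeroI[OF a(1) M] by blast
    then obtain b where "b \<in> carrier R" "\<one> \<ominus> b \<otimes> a \<in> M" using comax M a(1) by blast
    then show ?thesis using a lmult by (intro exI[of _ "b \<otimes> a"]) auto
  qed
  then obtain u where u: "\<And>M. M \<in> \<N> \<Longrightarrow> u M \<in> carrier R" "\<And>M. M \<in> \<N> \<Longrightarrow> \<one> \<ominus> u M \<in> M"
    "\<And>M N. M \<in> \<N> \<Longrightarrow> N \<in> \<N> - {M} \<Longrightarrow> u M \<in> N"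
    by metis
  have "minimal_right_ideal ((\<otimes>) (u M) ` carrier R) R" if M: "M \<in> \<N>" for M
  proof (rule minimal_right_ideal_idempotent[OF semiprime])
    note uc = u(1)[OF M]
    show "u M \<in> carrier R" by (rule uc)
    show "u M \<noteq> \<zero>"
      using u(2)[OF M] max M N(1) by (auto simp: maximal_left_ideal_def minus_eq)
    have "u M \<otimes> (\<one> \<ominus> u M) = \<zero>"
    proof (rule zeroI[OF _ M])
      show "u M \<otimes> (\<one> \<ominus> u M) \<in> carrier R" using uc by simp
      show "u M \<otimes> (\<one> \<ominus> u M) \<in> M" by (rule lmult[OF M uc u(2)[OF M]])
      fix N assume N: "N \<in> \<N> - {M}"
      have "u M \<otimes> (\<one> \<ominus> u M) = u M \<ominus> u M \<otimes> u M"
        using uc by (simp add: minus_eq r_distr r_minus)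
      then show "u M \<otimes> (\<one> \<ominus> u M) \<in> N"
        using N u(3)[OF M N] lmult[OF _ uc] by (simp add: additive_subgroup_diff[OF sub])
    qed
    then have "u M \<ominus> u M \<otimes> u M = \<zero>"
      using uc by (simp add: minus_eq r_distr r_minus)
    then show "u M \<otimes> u M = u M" using uc by (simp add: r_right_minus_eq)
    fix y assume y: "y \<in> carrier R" "u M \<otimes> y \<otimes> u M \<noteq> \<zero>"
    define v where "v = u M \<otimes> y \<otimes> u M"
    have vc: "v \<in> carrier R" using y uc by (simp add: v_def)
    have vN: "v \<in> N" if "N \<in> \<N> - {M}" for N
      unfolding v_def using that lmult[OF _ _ u(3)[OF M that], of "u M \<otimes> y"] uc y(1) by simp
    then have "v \<notin> M" using zeroI[OF vc M] y(2) by (auto simp: v_def)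
    then obtain b where b: "b \<in> carrier R" "\<one> \<ominus> b \<otimes> v \<in> M" using comax[OF M vc] by blast
    have eq: "u M \<otimes> (\<one> \<ominus> b \<otimes> v) = u M \<ominus> (u M \<otimes> b) \<otimes> v"
      using uc vc b(1) by (simp add: minus_eq r_distr r_minus m_assoc)
    have "u M \<ominus> (u M \<otimes> b) \<otimes> v = \<zero>"
    proof (rule zeroI[OF _ M])
      show "u M \<ominus> (u M \<otimes> b) \<otimes> v \<in> carrier R" using uc vc b(1) by simp
      show "u M \<ominus> (u M \<otimes> b) \<otimes> v \<in> M" using lmult[OF M uc b(2)] eq by simp
      fix N assume N: "N \<in> \<N> - {M}"
      then show "u M \<ominus> (u M \<otimes> b) \<otimes> v \<in> N"
        using u(3)[OF M N] lmult[OF _ _ vN[OF N], of "u M \<otimes> b"] uc b(1)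
          by (simp add: additive_subgroup_diff[OF sub])
    qed
    then have "(u M \<otimes> b) \<otimes> v = u M" using uc vc b(1) by (simp add: r_right_minus_eq)
    then show "\<exists>z\<in>carrier R. z \<otimes> (u M \<otimes> y \<otimes> u M) = u M"
      using uc b(1) unfolding v_def by (intro bexI[of _ "u M \<otimes> b"]) auto
  qed
  moreover have "(\<Oplus>M\<in>\<N>. u M) = \<one>"
  proof -
    let ?s = "\<Oplus>M\<in>\<N>. u M"
    have sc: "?s \<in> carrier R" using u(1) by auto
    have "\<one> \<ominus> ?s \<in> M" if M: "M \<in> \<N>" for M
    proof -
      let ?t = "\<Oplus>N\<in>\<N> - {M}. u N"
      have tM: "?t \<in> M"
        using Nfin M u(3) by (intro additive_subgroup_finsum[OF sub]) auto
      have tc: "?t \<in> carrier R" using u(1) by auto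
      have "?s = (\<Oplus>N\<in>insert M (\<N> - {M}). u N)" using M by (simp add: insert_absorb)
      also have "\<dots> = u M \<oplus> ?t" using Nfin M u(1) by (subst finsum_insert) auto
      finally have "\<one> \<ominus> ?s = (\<one> \<ominus> u M) \<ominus> ?t"
        using u(1)[OF M] tc by (simp add: minus_eq minus_add a_assoc)
      then show ?thesis using additive_subgroup_diff[OF sub[OF M] u(2)[OF M] tM] by simp
    qed
    then have "\<one> \<ominus> ?s = \<zero>" using N(2) sc unfolding Z_def by blast
    then show ?thesis using sc by (simp add: r_right_minus_eq)
  qed
  ultimately show ?thesis using Nfin u(1) by blast
qed

section \<open>Rings in which 1 is a sum of generators of minimal right ideals\<close>

lemma faithful_sum_one:
  assumes "finite I" "\<And>i. i \<in> I \<Longrightarrow> u i \<in> carrier R" "(\<Oplus>i\<in>I. u i) = \<one>"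
    and "x \<in> carrier R" "\<And>i. i \<in> I \<Longrightarrow> u i \<otimes> x = \<zero>"
  shows "x = \<zero>"
proof -
  have "x = (\<Oplus>i\<in>I. u i) \<otimes> x" using assms(3,4) by simp
  also have "\<dots> = (\<Oplus>i\<in>I. u i \<otimes> x)" using assms by (intro finsum_ldistr) auto
  also have "\<dots> = \<zero>" using assms(2,5) by (intro add.finprod_one_eqI) auto
  finally show ?thesis .
qed

text \<open>
Induction on the set F of those u that suffice to detect zero in a descending chain A. Removing
one u from F, the chain of the elements of A n killed by u becomes stationary by induction, and so
does the chain of the images u A n, which are zero or all of the minimal right ideal u R;
kernel and image together determine A n among the members of the chain.
\<close>

lemma right_artinian_if_sum_one:
  assumes "finite I" "\<And>i. i \<in> I \<Longrightarrow> u i \<in> carrier R"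
    and "\<And>i. i \<in> I \<Longrightarrow> minimal_right_ideal ((\<otimes>) (u i) ` carrier R) R" "(\<Oplus>i\<in>I. u i) = \<one>"
  shows "right_artinian R"
proof -
  have stable: "\<exists>N. \<forall>n\<ge>N. A n = A N"
    if "F \<subseteq> I" "\<And>n. right_ideal (A n) R" "\<And>n. A (Suc n) \<subseteq> A n"
      and "\<And>n x. x \<in> A n \<Longrightarrow> (\<And>i. i \<in> F \<Longrightarrow> u i \<otimes> x = \<zero>) \<Longrightarrow> x = \<zero>"
    for F and A :: "nat \<Rightarrow> 'a set"
    using finite_subset[OF that(1) assms(1)] that
  proof (induction F arbitrary: A rule: finite_induct)
    case empty
    then have "A n = {\<zero>}" for n using right_ideal_zero by blast
    then show ?case by simp
  next
    case (insert i F)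
    have i: "u i \<in> carrier R" "minimal_right_ideal ((\<otimes>) (u i) ` carrier R) R"
      using insert.prems(1) assms by auto
    have ri: "right_ideal (A n) R" for n by (rule insert.prems)
    have mono: "A m \<subseteq> A n" if "n \<le> m" for m n
      using lift_Suc_antimono_le[of A] insert.prems(3) that by blast
    define A' where "A' n = A n \<inter> {x \<in> carrier R. u i \<otimes> x = \<zero>}" for n
    have "\<exists>N. \<forall>n\<ge>N. A' n = A' N"
    proof (rule insert.IH)
      show "F \<subseteq> I" using insert.prems(1) by simp
      show "right_ideal (A' n) R" for n
        unfolding A'_def by (intro right_ideal_Int ri right_ideal_kernel i)
      show "A' (Suc n) \<subseteq> A' n" for n using insert.prems(3) by (auto simp: A'_def)
      show "x = \<zero>" if "x \<in> A' n" "\<And>j. j \<in> F \<Longrightarrow> u j \<otimes> x = \<zero>" for n x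
        using insert.prems(4)[of x n] that by (auto simp: A'_def)
    qed
    then obtain N where N: "\<And>n. n \<ge> N \<Longrightarrow> A' n = A' N" by blast
    define B where "B n = (\<otimes>) (u i) ` A n" for n
    have B: "B n = {\<zero>} \<or> B n = (\<otimes>) (u i) ` carrier R" for n
    proof -
      have "right_ideal (B n) R" unfolding B_def by (rule right_ideal_image[OF ri i(1)])
      moreover have "B n \<subseteq> (\<otimes>) (u i) ` carrier R"
        unfolding B_def using right_ideal_carrier[OF ri] by blast
      ultimately show ?thesis using i(2) unfolding minimal_right_ideal_def by blast
    qed
    have Bmono: "B m \<subseteq> B n" if "n \<le> m" for m n using mono[OF that] by (auto simp: B_def)
    have "\<exists>N. \<forall>n\<ge>N. B n = B N"
    proof (cases "\<exists>N. B N = {\<zero>}")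
      case True
      then obtain N where NB: "B N = {\<zero>}" by blast
      have "\<zero> \<in> B n" for n
        unfolding B_def using right_ideal_zero[OF right_ideal_image[OF ri i(1)]] .
      then have "B n = B N" if "N \<le> n" for n using Bmono[OF that] NB by auto
      then show ?thesis by blast
    next
      case False
      then show ?thesis using B by metis
    qed
    then obtain N' where N': "\<And>n. n \<ge> N' \<Longrightarrow> B n = B N'" by blast
    define K where "K = max N N'"
    have "A K \<subseteq> A n" if n: "K \<le> n" for n
    proof
      fix x assume x: "x \<in> A K"
      have "B n = B K" using N'[of n] N'[of K] n by (simp add: K_def)
      moreover have "u i \<otimes> x \<in> B K" using x by (simp add: B_def)
      ultimately obtain y where y: "y \<in> A n" "u i \<otimes> x = u i \<otimes> y" by (auto simp: B_def)
      have c: "x \<in> carrier R" "y \<in> carrier R" using x y right_ideal_carrier[OF ri] by auto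
      have "x \<ominus> y \<in> A K" using x y mono[OF n] right_ideal_diff[OF ri] by blast
      moreover have "u i \<otimes> (x \<ominus> y) = \<zero>"
        using c i(1) y(2) by (simp add: minus_eq r_distr r_minus r_neg)
      ultimately have "x \<ominus> y \<in> A' K" using c by (simp add: A'_def)
      then have "x \<ominus> y \<in> A n" using N[of n] N[of K] n by (auto simp: K_def A'_def)
      then have "(x \<ominus> y) \<oplus> y \<in> A n" using right_ideal_add[OF ri] y(1) by blast
      then show "x \<in> A n" using c by (simp add: minus_eq a_assoc l_neg)
    qed
    then have "\<forall>n\<ge>K. A n = A K" using mono by blast
    then show ?case by blast
  qed
  show ?thesis
    unfolding right_artinian_def
  proof (intro allI impI)
    fix A :: "nat \<Rightarrow> 'a set"
    assume A: "(\<forall>n. right_ideal (A n) R) \<and> (\<forall>n. A (Suc n) \<subseteq> A n)"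
    show "\<exists>N. \<forall>n\<ge>N. A n = A N"
    proof (rule stable[OF subset_refl])
      show "x = \<zero>" if "x \<in> A n" "\<And>i. i \<in> I \<Longrightarrow> u i \<otimes> x = \<zero>" for n x
        using faithful_sum_one[OF assms(1,2,4) right_ideal_carrier that(2)] A that(1) by blast
    qed (use A in auto)
  qed
qed

lemma minimal_right_ideals_carrier: "\<Union> {I. minimal_right_ideal I R} \<subseteq> carrier R"
  using minimal_right_ideal_right_ideal right_ideal_carrier by blast

lemma right_socle_subgroup: "additive_subgroup (right_socle R) R"
  unfolding right_socle_def additive_subgroup_def
  using minimal_right_ideals_carrier by (intro add.generate_is_subgroup) simp

lemma right_socle_if_sum_one:
  assumes "finite I" "\<And>i. i \<in> I \<Longrightarrow> u i \<in> carrier R"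
    and "\<And>i. i \<in> I \<Longrightarrow> minimal_right_ideal ((\<otimes>) (u i) ` carrier R) R" "(\<Oplus>i\<in>I. u i) = \<one>"
  shows "right_socle R = carrier R"
proof
  show "right_socle R \<subseteq> carrier R"
    using additive_subgroup.a_subset[OF right_socle_subgroup] .
  show "carrier R \<subseteq> right_socle R"
  proof
    fix x assume x: "x \<in> carrier R"
    have "u i \<otimes> x \<in> right_socle R" if "i \<in> I" for i
      unfolding right_socle_def using assms(3)[OF that] x by (intro generate.incl) auto
    then have "(\<Oplus>i\<in>I. u i \<otimes> x) \<in> right_socle R"
      by (rule additive_subgroup_finsum[OF right_socle_subgroup assms(1)])
    moreover have "(\<Oplus>i\<in>I. u i \<otimes> x) = (\<Oplus>i\<in>I. u i) \<otimes> x"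
      using assms x by (intro finsum_ldistr[symmetric]) auto
    ultimately show "x \<in> right_socle R" using assms(4) x by simp
  qed
qed

text \<open>
R modulo this kernel is isomorphic to the simple module u R.
\<close>

lemma maximal_right_ideal_kernel:
  assumes u: "u \<in> carrier R" and min: "minimal_right_ideal ((\<otimes>) u ` carrier R) R"
  shows "maximal_right_ideal {x \<in> carrier R. u \<otimes> x = \<zero>} R" (is "maximal_right_ideal ?M R")
proof -
  have uin: "u \<in> (\<otimes>) u ` carrier R" using u by (metis image_eqI one_closed r_one)
  have uz: "u \<noteq> \<zero>"
  proof
    assume "u = \<zero>"
    then have "(\<otimes>) u ` carrier R = {\<zero>}" using zero_closed by force
    then show False using min by (simp add: minimal_right_ideal_def)
  qed
  have "K = ?M \<or> K = carrier R" if K: "right_ideal K R" "?M \<subseteq> K" for K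
  proof (cases "K \<subseteq> ?M")
    case False
    then obtain y where y: "y \<in> K" "u \<otimes> y \<noteq> \<zero>" using right_ideal_carrier[OF K(1)] by auto
    note yc = right_ideal_carrier[OF K(1) y(1)]
    have "u \<otimes> y \<in> (\<otimes>) u ` carrier R" using yc by simp
    from minimal_right_ideal_principal[OF min this y(2)] uin
    obtain c where c: "c \<in> carrier R" "u = u \<otimes> y \<otimes> c" by auto
    have "u \<otimes> (\<one> \<ominus> y \<otimes> c) = u \<ominus> u \<otimes> y \<otimes> c"
      using u yc c(1) by (simp add: minus_eq r_distr r_minus m_assoc)
    also have "\<dots> = \<zero>" using c(2) u by (simp add: r_right_minus_eq)
    finally have "\<one> \<ominus> y \<otimes> c \<in> K" using K(2) yc c(1) by auto
    then have "(\<one> \<ominus> y \<otimes> c) \<oplus> y \<otimes> c \<in> K"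
      using right_ideal_add[OF K(1)] right_ideal_mult[OF K(1) y(1) c(1)] by blast
    then have "\<one> \<in> K" using yc c(1) by (simp add: minus_eq a_assoc l_neg)
    then have "carrier R \<subseteq> K" using right_ideal_mult[OF K(1), of \<one>] by auto
    then show ?thesis using right_ideal_carrier[OF K(1)] by auto
  qed (use K(2) in auto)
  moreover have "\<one> \<notin> ?M" using u uz by simp
  ultimately show ?thesis
    unfolding maximal_right_ideal_def using right_ideal_kernel[OF u] one_closed by blast
qed

lemma jacobson_radical_if_sum_one:
  assumes "finite I" "\<And>i. i \<in> I \<Longrightarrow> u i \<in> carrier R"
    and "\<And>i. i \<in> I \<Longrightarrow> minimal_right_ideal ((\<otimes>) (u i) ` carrier R) R" "(\<Oplus>i\<in>I. u i) = \<one>"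
    and x: "x \<in> jacobson_radical R"
  shows "x = \<zero>"
proof (rule faithful_sum_one[OF assms(1,2,4)])
  show "x \<in> carrier R" using x by (simp add: jacobson_radical_def)
  show "u i \<otimes> x = \<zero>" if "i \<in> I" for i
    using x maximal_right_ideal_kernel[OF assms(2,3)[OF that]] by (auto simp: jacobson_radical_def)
qed

text \<open>
The radical vanishes because it is contained in the kernels of left multiplication by the
summands u of 1, whose intersection is zero.
\<close>

lemma semisimple_artinian_if_semiprime:
  assumes "\<And>x. x \<in> carrier R \<Longrightarrow> x \<noteq> \<zero> \<Longrightarrow> \<exists>b\<in>carrier R. x \<otimes> b \<otimes> x \<noteq> \<zero>"
    and "finite \<M>"
    and "\<And>M. M \<in> \<M> \<Longrightarrow> maximal_left_ideal M R"
    and "\<And>x. x \<in> carrier R \<Longrightarrow> (\<And>M. M \<in> \<M> \<Longrightarrow> x \<in> M) \<Longrightarrow> x = \<zero>"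
  shows "semisimple_artinian R \<and> jacobson_radical R \<subseteq> {\<zero>}"
proof -
  have "\<exists>(\<N> :: 'a set set) u. finite \<N> \<and> (\<Oplus>M\<in>\<N>. u M) = \<one> \<and>
    (\<forall>M\<in>\<N>. u M \<in> carrier R \<and> minimal_right_ideal ((\<otimes>) (u M) ` carrier R) R)"
    by (rule one_eq_sum_minimal[OF assms])
  then obtain \<N> :: "'a set set" and u where u: "finite \<N>" "(\<Oplus>M\<in>\<N>. u M) = \<one>"
    "\<forall>M\<in>\<N>. u M \<in> carrier R \<and> minimal_right_ideal ((\<otimes>) (u M) ` carrier R) R"
    by (elim exE conjE)
  have c: "u M \<in> carrier R" and m: "minimal_right_ideal ((\<otimes>) (u M) ` carrier R) R"
    if "M \<in> \<N>" for M
    using u(3) that by auto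
  show ?thesis
    unfolding semisimple_artinian_def
  proof (intro conjI subsetI)
    show "right_socle R = carrier R" by (rule right_socle_if_sum_one[OF u(1) c m u(2)])
    show "right_artinian R" by (rule right_artinian_if_sum_one[OF u(1) c m u(2)])
    show "x \<in> {\<zero>}" if "x \<in> jacobson_radical R" for x
      using jacobson_radical_if_sum_one[OF u(1) c m u(2) that] by simp
  qed
qed

section \<open>Nilpotent ideals, quotients and the Jacobson radical\<close>

text \<open>
If x in N were outside a maximal right ideal M, then 1 = m + y with m in M and y in x R, hence in N.
Since y^k = m y^k + y^(k+1), membership in M descends from y^n = 0 to y^0 = 1.
\<close>

lemma nilpotent_ideal_le_jacobson_radical:
  assumes "nilpotent_ideal N R"
  shows "N \<subseteq> jacobson_radical R"
proof
  obtain n :: nat where N: "ideal N R" and n: "N [^]\<^bsub>ideals_set R\<^esub> n = {\<zero>}"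
    using assms by (auto simp: nilpotent_ideal_def)
  fix x assume x: "x \<in> N"
  note xc = ideal.Icarr[OF N x]
  have "x \<in> M" if M: "maximal_right_ideal M R" for M
  proof (rule ccontr)
    assume xM: "x \<notin> M"
    have Mri: "right_ideal M R" using M by (simp add: maximal_right_ideal_def)
    define K where "K = {m \<oplus> x \<otimes> r |m r. m \<in> M \<and> r \<in> carrier R}"
    have "right_ideal K R"
    proof (rule right_idealI)
      show "K \<subseteq> carrier R" using right_ideal_carrier[OF Mri] xc by (auto simp: K_def)
      have "\<zero> = \<zero> \<oplus> x \<otimes> \<zero>" using xc by simp
      then show "\<zero> \<in> K" unfolding K_def using right_ideal_zero[OF Mri] by blast
      fix a assume "a \<in> K"
      then obtain m r where a: "m \<in> M" "r \<in> carrier R" "a = m \<oplus> x \<otimes> r" by (auto simp: K_def)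
      note mc = right_ideal_carrier[OF Mri a(1)]
      show "a \<oplus> b \<in> K" if "b \<in> K" for b
      proof -
        from that obtain m' r' where b: "m' \<in> M" "r' \<in> carrier R" "b = m' \<oplus> x \<otimes> r'"
          by (auto simp: K_def)
        have "a \<oplus> b = (m \<oplus> m') \<oplus> x \<otimes> (r \<oplus> r')"
          using a b mc right_ideal_carrier[OF Mri b(1)] xc by (simp add: r_distr a_ac)
        then show ?thesis
          unfolding K_def using right_ideal_add[OF Mri a(1) b(1)] a(2) b(2) by blast
      qed
      show "a \<otimes> s \<in> K" if "s \<in> carrier R" for s
      proof -
        have "a \<otimes> s = m \<otimes> s \<oplus> x \<otimes> (r \<otimes> s)" using a mc xc that by (simp add: l_distr m_assoc)
        then show ?thesis
          unfolding K_def using right_ideal_mult[OF Mri a(1) that] a(2) that by blast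
      qed
    qed
    moreover have "M \<subseteq> K"
    proof
      fix m assume m: "m \<in> M"
      then have "m = m \<oplus> x \<otimes> \<zero>" using right_ideal_carrier[OF Mri] xc by simp
      then show "m \<in> K" unfolding K_def using m by blast
    qed
    moreover have "x \<in> K"
    proof -
      have "x = \<zero> \<oplus> x \<otimes> \<one>" using xc by simp
      then show ?thesis unfolding K_def using right_ideal_zero[OF Mri] by blast
    qed
    ultimately have "K = carrier R" using M xM unfolding maximal_right_ideal_def by blast
    then obtain m r where mr: "m \<in> M" "r \<in> carrier R" "\<one> = m \<oplus> x \<otimes> r"
      using one_closed unfolding K_def by blast
    define y where "y = x \<otimes> r"
    have yN: "y \<in> N" using ideal.I_r_closed[OF N x mr(2)] by (simp add: y_def)
    note yc = ideal.Icarr[OF N yN]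
    note mc = right_ideal_carrier[OF Mri mr(1)]
    have pow: "y [^] j \<in> N [^]\<^bsub>ideals_set R\<^esub> j" for j :: nat
    proof (induction j)
      case 0
      show ?case unfolding ideal_pow_0 by simp
    next
      case (Suc j)
      then show ?case unfolding ideal_pow_Suc using yN by (simp add: ideal_prod.prod)
    qed
    have "y [^] (n - j) \<in> M" for j
    proof (induction j)
      case 0
      then show ?case using pow[of n] n right_ideal_zero[OF Mri] by simp
    next
      case (Suc j)
      show ?case
      proof (cases "j < n")
        case True
        then obtain k where k: "n - j = Suc k" "n - Suc j = k"
          by (metis Suc_diff_Suc)
        have "m \<oplus> y = \<one>" using mr(3) by (simp add: y_def)
        then have "y [^] k = (m \<oplus> y) \<otimes> y [^] k" using yc by simp
        also have "\<dots> = m \<otimes> y [^] k \<oplus> y [^] Suc k"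
          using mc yc nat_pow_Suc2[OF yc, of k] by (simp add: l_distr)
        finally show ?thesis
          using right_ideal_add[OF Mri right_ideal_mult[OF Mri mr(1)]] Suc yc k by (metis nat_pow_closed)
      qed (use Suc in simp)
    qed
    from this[of n] have "\<one> \<in> M" by simp
    then have "carrier R \<subseteq> M" using right_ideal_mult[OF Mri, of \<one>] by auto
    then show False
      using M right_ideal_carrier[OF Mri] unfolding maximal_right_ideal_def by blast
  qed
  then show "x \<in> jacobson_radical R" using xc by (simp add: jacobson_radical_def)
qed

end

text \<open>
This is how the radical of a ring is seen to map into the radical of a quotient.
\<close>

lemma (in ring_hom_ring) maximal_right_ideal_vimage:
  assumes surj: "h ` carrier R = carrier S" and M: "maximal_right_ideal M S"
  shows "maximal_right_ideal {a \<in> carrier R. h a \<in> M} R" (is "maximal_right_ideal ?M R")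
proof -
  have Mri: "right_ideal M S" using M by (simp add: maximal_right_ideal_def)
  have ri: "right_ideal ?M R"
    by (rule R.right_idealI)
       (auto intro: S.right_ideal_zero[OF Mri] S.right_ideal_add[OF Mri] S.right_ideal_mult[OF Mri])
  have one: "\<one> \<notin> ?M"
  proof
    assume "\<one> \<in> ?M"
    then have "\<one>\<^bsub>S\<^esub> \<in> M" by simp
    then have "carrier S \<subseteq> M" using S.right_ideal_mult[OF Mri, of "\<one>\<^bsub>S\<^esub>"] by auto
    then show False
      using M S.right_ideal_carrier[OF Mri] unfolding maximal_right_ideal_def by blast
  qed
  have "K = ?M \<or> K = carrier R" if K: "right_ideal K R" "?M \<subseteq> K" for K
  proof -
    note Kc = R.right_ideal_carrier[OF K(1)]
    have pull: "a \<in> K" if a: "a \<in> carrier R" "h a \<in> h ` K" for a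
    proof -
      obtain k where k: "k \<in> K" "h a = h k" using a(2) by blast
      have "h (a \<ominus> k) = \<zero>\<^bsub>S\<^esub>"
        using a(1) Kc[OF k(1)] k(2) by (simp add: R.minus_eq S.r_neg)
      then have "a \<ominus> k \<in> K"
        using K(2) a(1) Kc[OF k(1)] S.right_ideal_zero[OF Mri] by auto
      then have "(a \<ominus> k) \<oplus> k \<in> K" using R.right_ideal_add[OF K(1)] k(1) by blast
      then show ?thesis using a(1) Kc[OF k(1)] by (simp add: R.minus_eq R.a_assoc R.l_neg)
    qed
    have "right_ideal (h ` K) S"
    proof (rule S.right_idealI)
      show "h ` K \<subseteq> carrier S" using Kc by auto
      show "\<zero>\<^bsub>S\<^esub> \<in> h ` K" using R.right_ideal_zero[OF K(1)] hom_zero by (metis image_eqI)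
      fix x assume "x \<in> h ` K"
      then obtain k where k: "k \<in> K" "x = h k" by auto
      show "x \<oplus>\<^bsub>S\<^esub> y \<in> h ` K" if "y \<in> h ` K" for y
      proof -
        from that obtain l where l: "l \<in> K" "y = h l" by auto
        have "x \<oplus>\<^bsub>S\<^esub> y = h (k \<oplus> l)" using k l Kc by simp
        then show ?thesis using R.right_ideal_add[OF K(1) k(1) l(1)] by blast
      qed
      show "x \<otimes>\<^bsub>S\<^esub> s \<in> h ` K" if "s \<in> carrier S" for s
      proof -
        from that surj obtain r where r: "r \<in> carrier R" "s = h r" by auto
        have "x \<otimes>\<^bsub>S\<^esub> s = h (k \<otimes> r)" using k r Kc by simp
        then show ?thesis using R.right_ideal_mult[OF K(1) k(1) r(1)] by blast
      qed
    qed
    moreover have "M \<subseteq> h ` K"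
    proof
      fix m assume m: "m \<in> M"
      then obtain a where "a \<in> carrier R" "m = h a"
        using S.right_ideal_carrier[OF Mri] surj by blast
      then show "m \<in> h ` K" using m K(2) by auto
    qed
    ultimately consider "h ` K = M" | "h ` K = carrier S"
      using M unfolding maximal_right_ideal_def by blast
    then show ?thesis
    proof cases
      case 1
      then show ?thesis using K(2) Kc by auto
    next
      case 2
      then show ?thesis using pull Kc by auto
    qed
  qed
  then show ?thesis
    unfolding maximal_right_ideal_def using ri one R.one_closed by blast
qed

context ring
begin

section \<open>The left annihilator of the right socle\<close>

text \<open>
The socle is generated by the minimal right ideals, so its left annihilator is already determined by
their elements. Working with these elements avoids sums.
\<close>

definition simple_left_annihilator :: "'a set" where
  "simple_left_annihilator =
     {a \<in> carrier R. \<forall>k\<in>\<Union> {I. minimal_right_ideal I R}. a \<otimes> k = \<zero>}"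

text \<open>
Closure under right multiplication by x holds because x I is again minimal or zero for a
minimal right ideal I: the socle is a two-sided ideal.
\<close>

lemma ideal_simple_left_annihilator: "ideal simple_left_annihilator R"
proof (rule idealI[OF ring_axioms])
  let ?T = "\<Union> {I. minimal_right_ideal I R}"
  have Tc: "k \<in> carrier R" if "k \<in> ?T" for k using that minimal_right_ideals_carrier by blast
  have mem: "a \<in> simple_left_annihilator \<longleftrightarrow> a \<in> carrier R \<and> (\<forall>k\<in>?T. a \<otimes> k = \<zero>)" for a
    by (simp add: simple_left_annihilator_def)
  show "subgroup simple_left_annihilator (add_monoid R)"
  proof (rule add.subgroupI)
    have "\<zero> \<in> simple_left_annihilator" unfolding mem using Tc l_null zero_closed by blast
    then show "simple_left_annihilator \<noteq> {}" by blast
    show "\<ominus> a \<in> simple_left_annihilator" if "a \<in> simple_left_annihilator" for a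
      using that Tc unfolding mem by (metis a_inv_closed l_minus minus_zero)
    show "a \<oplus> b \<in> simple_left_annihilator"
      if "a \<in> simple_left_annihilator" "b \<in> simple_left_annihilator" for a b
      using that Tc unfolding mem by (metis add.m_closed l_distr l_zero zero_closed)
  qed (use mem in blast)
  fix a x assume a: "a \<in> simple_left_annihilator" and x: "x \<in> carrier R"
  have ac: "a \<in> carrier R" "\<And>k. k \<in> ?T \<Longrightarrow> a \<otimes> k = \<zero>"
    using a by (auto simp: simple_left_annihilator_def)
  have "x \<otimes> a \<otimes> k = \<zero>" if "k \<in> ?T" for k
    using ac(1) ac(2)[OF that] x Tc[OF that] by (simp add: m_assoc)
  then show "x \<otimes> a \<in> simple_left_annihilator" unfolding mem using ac(1) x by blast
  have "a \<otimes> x \<otimes> k = \<zero>" if k: "k \<in> ?T" for k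
  proof -
    have "a \<otimes> (x \<otimes> k) = \<zero>"
    proof (cases "x \<otimes> k = \<zero>")
      case False
      with k have "x \<otimes> k \<in> ?T" using minimal_right_ideal_image[OF _ x] by blast
      then show ?thesis by (rule ac(2))
    qed (use ac(1) in simp)
    then show ?thesis using ac(1) x Tc[OF k] by (simp add: m_assoc)
  qed
  then show "a \<otimes> x \<in> simple_left_annihilator" unfolding mem using ac(1) x by blast
qed

lemma simple_left_annihilator_socle:
  assumes "b \<in> simple_left_annihilator" "s \<in> right_socle R"
  shows "b \<otimes> s = \<zero>"
proof -
  have b: "b \<in> carrier R" "\<And>k. k \<in> \<Union> {I. minimal_right_ideal I R} \<Longrightarrow> b \<otimes> k = \<zero>"
    using assms(1) by (auto simp: simple_left_annihilator_def)
  have "s \<in> carrier R \<and> b \<otimes> s = \<zero>"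
    using assms(2) unfolding right_socle_def
  proof (induction rule: generate.induct)
    case one
    then show ?case using b by simp
  next
    case (incl k)
    then show ?case using b minimal_right_ideals_carrier by blast
  next
    case (inv k)
    then have "k \<in> carrier R" "b \<otimes> k = \<zero>" using b minimal_right_ideals_carrier by blast+
    then show ?case using b(1) by (simp add: a_inv_def[symmetric] r_minus)
  next
    case (eng x y)
    then show ?case using b(1) by (simp add: r_distr)
  qed
  then show ?thesis by simp
qed

lemma nilpotent_simple_left_annihilator:
  assumes acc: "acc_right_annihilators R" and ess: "right_essential R (right_socle R)"
  shows "nilpotent_ideal simple_left_annihilator R"
proof (rule nilpotent_if_singular[OF acc ideal_simple_left_annihilator])
  fix b a assume b: "b \<in> simple_left_annihilator" and a: "a \<in> carrier R" "a \<noteq> \<zero>"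
  have "a \<in> (\<otimes>) a ` carrier R" using a(1) by (metis image_eqI one_closed r_one)
  then have "(\<otimes>) a ` carrier R \<inter> right_socle R \<noteq> {\<zero>}"
    using ess right_ideal_principal[OF a(1)] a(2) unfolding right_essential_def by blast
  moreover have "\<zero> \<in> (\<otimes>) a ` carrier R \<inter> right_socle R"
    using right_ideal_zero[OF right_ideal_principal[OF a(1)]]
      additive_subgroup.zero_closed[OF right_socle_subgroup] by blast
  ultimately obtain r where "r \<in> carrier R" "a \<otimes> r \<in> right_socle R" "a \<otimes> r \<noteq> \<zero>" by blast
  then show "\<exists>r\<in>carrier R. a \<otimes> r \<noteq> \<zero> \<and> b \<otimes> (a \<otimes> r) = \<zero>"
    using simple_left_annihilator_socle[OF b] by blast
qed

lemma carrier_Quot: "carrier (R Quot N) = (+>) N ` carrier R"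
  by (auto simp: FactRing_def A_RCOSETS_def RCOSETS_def a_r_coset_def)

text \<open>
Mininjectivity enters as the cancellation b a k = k. It shows at once that l(k) is
a maximal left ideal (1 - b a kills k) and that the quotient is semiprime (x b x k = x k).
\<close>

lemma semisimple_artinian_quotient:
  assumes inj: "right_mininjective R" and acc: "acc_right_annihilators R"
  defines "B \<equiv> R Quot simple_left_annihilator"
  shows "semisimple_artinian B \<and> jacobson_radical B \<subseteq> {\<zero>\<^bsub>B\<^esub>}"
proof -
  let ?T = "\<Union> {I. minimal_right_ideal I R}"
  let ?N = simple_left_annihilator
  interpret N: ideal ?N R by (rule ideal_simple_left_annihilator)
  define h where "h = (+>) ?N"
  interpret H: ring_hom_ring R B h unfolding B_def h_def by (rule N.rcos_ring_hom_ring)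
  have surj: "carrier B = h ` carrier R"
    unfolding B_def h_def by (rule carrier_Quot)
  have ker: "h a = \<zero>\<^bsub>B\<^esub> \<longleftrightarrow> a \<in> ?N" if "a \<in> carrier R" for a
    using that N.rcos_const_imp_mem a_rcos_zero[OF ideal_simple_left_annihilator]
    by (auto simp: B_def h_def FactRing_def)
  have Tc: "k \<in> carrier R" if "k \<in> ?T" for k using that minimal_right_ideals_carrier by blast
  have killN: "a \<otimes> k = \<zero>" if "a \<in> ?N" "k \<in> ?T" for a k
    using that unfolding simple_left_annihilator_def by blast
  have cancel: "\<exists>b\<in>carrier R. b \<otimes> (a \<otimes> k) = k"
    if "k \<in> ?T" "a \<in> carrier R" "a \<otimes> k \<noteq> \<zero>" for a k
    using that mininjective_left_inverse[OF inj] by blast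
  obtain K where K: "finite K" "K \<subseteq> ?T"
    and KN: "\<And>a. a \<in> carrier R \<Longrightarrow> (\<And>k. k \<in> K \<Longrightarrow> a \<otimes> k = \<zero>) \<Longrightarrow> a \<in> ?N"
    using finite_left_annihilator[OF acc minimal_right_ideals_carrier]
    unfolding simple_left_annihilator_def by auto
  define L where "L k = h ` {a \<in> carrier R. a \<otimes> k = \<zero>}" for k
  have Liff: "h a \<in> L k \<longleftrightarrow> a \<otimes> k = \<zero>" if k: "k \<in> ?T" and a: "a \<in> carrier R" for a k
  proof
    assume "h a \<in> L k"
    then obtain c where c: "c \<in> carrier R" "c \<otimes> k = \<zero>" "h a = h c" by (auto simp: L_def)
    then have "h (a \<ominus> c) = \<zero>\<^bsub>B\<^esub>" using a by (simp add: minus_eq H.S.r_neg)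
    then have "a \<ominus> c \<in> ?N" using ker a c(1) by simp
    then have "(a \<ominus> c) \<otimes> k = \<zero>" using k by (rule killN)
    then show "a \<otimes> k = \<zero>" using a c Tc[OF k] by (simp add: minus_eq l_distr l_minus)
  qed (use a in \<open>auto simp: L_def\<close>)
  show ?thesis
  proof (rule H.S.semisimple_artinian_if_semiprime[of "L ` (K - {\<zero>})"])
    show "finite (L ` (K - {\<zero>}))" using K(1) by simp
  next
    fix Y assume Y: "Y \<in> carrier B" "Y \<noteq> \<zero>\<^bsub>B\<^esub>"
    then obtain x where x: "x \<in> carrier R" "Y = h x" using surj by auto
    then obtain k where k: "k \<in> ?T" "x \<otimes> k \<noteq> \<zero>"
      using Y(2) ker[OF x(1)] unfolding simple_left_annihilator_def by blast
    obtain b where b: "b \<in> carrier R" "b \<otimes> (x \<otimes> k) = k" using cancel[OF k(1) x(1) k(2)] by blast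
    have "(x \<otimes> b \<otimes> x) \<otimes> k = x \<otimes> k" using x b Tc[OF k(1)] by (simp add: m_assoc)
    then have "x \<otimes> b \<otimes> x \<notin> ?N" using killN[OF _ k(1)] k(2) by auto
    then have "h (x \<otimes> b \<otimes> x) \<noteq> \<zero>\<^bsub>B\<^esub>"
      using ker[of "x \<otimes> b \<otimes> x"] x(1) b(1) by (metis m_closed)
    then show "\<exists>b\<in>carrier B. Y \<otimes>\<^bsub>B\<^esub> b \<otimes>\<^bsub>B\<^esub> Y \<noteq> \<zero>\<^bsub>B\<^esub>"
      using x b(1) by (intro bexI[of _ "h b"]) auto
  next
    fix M assume "M \<in> L ` (K - {\<zero>})"
    then obtain k where k: "k \<in> ?T" "k \<noteq> \<zero>" "M = L k" using K(2) by auto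
    note kc = Tc[OF k(1)]
    have sub: "additive_subgroup (L k) B"
      unfolding additive_subgroup_def
    proof (rule H.S.add.subgroupI)
      show "L k \<subseteq> carrier B" by (auto simp: L_def)
      show "L k \<noteq> {}" using Liff[OF k(1) zero_closed] kc by auto
      fix x assume "x \<in> L k"
      then obtain a where a: "a \<in> carrier R" "a \<otimes> k = \<zero>" "x = h a" by (auto simp: L_def)
      have "h (\<ominus> a) \<in> L k" using a kc Liff[OF k(1), of "\<ominus> a"] by (simp add: l_minus)
      then show "\<ominus>\<^bsub>B\<^esub> x \<in> L k" using a by simp
      fix y assume "y \<in> L k"
      then obtain c where c: "c \<in> carrier R" "c \<otimes> k = \<zero>" "y = h c" by (auto simp: L_def)
      have "h (a \<oplus> c) \<in> L k" using a c kc Liff[OF k(1), of "a \<oplus> c"] by (simp add: l_distr)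
      then show "x \<oplus>\<^bsub>B\<^esub> y \<in> L k" using a c by simp
    qed
    have left: "r \<otimes>\<^bsub>B\<^esub> x \<in> L k" if r: "r \<in> carrier B" and x: "x \<in> L k" for r x
    proof -
      obtain a where a: "a \<in> carrier R" "a \<otimes> k = \<zero>" "x = h a" using x by (auto simp: L_def)
      obtain s where s: "s \<in> carrier R" "r = h s" using r surj by auto
      have "h (s \<otimes> a) \<in> L k" using a s kc Liff[OF k(1), of "s \<otimes> a"] by (simp add: m_assoc)
      then show ?thesis using a s by simp
    qed
    have one: "\<one>\<^bsub>B\<^esub> \<notin> L k" using Liff[OF k(1) one_closed] kc k(2) by simp
    have "\<exists>b\<in>carrier B. \<one>\<^bsub>B\<^esub> \<ominus>\<^bsub>B\<^esub> b \<otimes>\<^bsub>B\<^esub> x \<in> L k" if x: "x \<in> carrier B - L k" for x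
    proof -
      obtain a where a: "a \<in> carrier R" "x = h a" using x surj by auto
      then have "a \<otimes> k \<noteq> \<zero>" using x Liff[OF k(1) a(1)] by simp
      then obtain b where b: "b \<in> carrier R" "b \<otimes> (a \<otimes> k) = k" using cancel[OF k(1) a(1)] by blast
      have "(\<one> \<ominus> b \<otimes> a) \<otimes> k = \<zero>"
        using a b kc by (simp add: minus_eq l_distr l_minus m_assoc r_neg)
      then have "h (\<one> \<ominus> b \<otimes> a) \<in> L k" using Liff[OF k(1), of "\<one> \<ominus> b \<otimes> a"] a b by simp
      then show ?thesis using a b by (intro bexI[of _ "h b"]) (auto simp: minus_eq H.S.minus_eq)
    qed
    then show "maximal_left_ideal M B"
      using sub left one unfolding k(3) maximal_left_ideal_def by blast
  next
    fix Y assume Y: "Y \<in> carrier B" "\<And>M. M \<in> L ` (K - {\<zero>}) \<Longrightarrow> Y \<in> M"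
    then obtain x where x: "x \<in> carrier R" "Y = h x" using surj by auto
    have "x \<in> ?N"
    proof (rule KN[OF x(1)])
      fix k assume k: "k \<in> K"
      show "x \<otimes> k = \<zero>"
      proof (cases "k = \<zero>")
        case False
        then have "h x \<in> L k" using Y(2) x k by blast
        then show ?thesis using Liff[of k x] k K(2) x(1) by blast
      qed (use x in simp)
    qed
    then show "Y = \<zero>\<^bsub>B\<^esub>" using x ker by simp
  qed
qed

end

theorem lemma2p11:
  fixes R :: "('a, 'b) ring_scheme"
  assumes "ring R"
    and "right_mininjective R"
    and "acc_right_annihilators R"
    and "right_essential R (right_socle R)"
  shows "semiprimary R"
proof -
  interpret ring R by fact
  define N where "N = simple_left_annihilator"
  interpret N: ideal N R unfolding N_def by (rule ideal_simple_left_annihilator)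
  interpret H: ring_hom_ring R "R Quot N" "a_r_coset R N" by (rule N.rcos_ring_hom_ring)
  have semisimple: "semisimple_artinian (R Quot N)"
    and jac: "jacobson_radical (R Quot N) \<subseteq> {N}"
    using semisimple_artinian_quotient[OF assms(2,3)] by (simp_all add: N_def FactRing_def)
  have nil: "nilpotent_ideal N R"
    unfolding N_def by (rule nilpotent_simple_left_annihilator[OF assms(3,4)])
  have "jacobson_radical R \<subseteq> N"
  proof
    fix x assume x: "x \<in> jacobson_radical R"
    then have xc: "x \<in> carrier R" by (simp add: jacobson_radical_def)
    have surj: "a_r_coset R N ` carrier R = carrier (R Quot N)"
      by (rule carrier_Quot[symmetric])
    have "N +>\<^bsub>R\<^esub> x \<in> M" if "maximal_right_ideal M (R Quot N)" for M
      using x H.maximal_right_ideal_vimage[OF surj that] by (auto simp: jacobson_radical_def)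
    then have "N +>\<^bsub>R\<^esub> x \<in> jacobson_radical (R Quot N)"
      using xc by (simp add: jacobson_radical_def)
    then have "N +>\<^bsub>R\<^esub> x = N"
      using jac by blast
    then show "x \<in> N" using N.rcos_const_imp_mem[OF xc] by simp
  qed
  then have "jacobson_radical R = N"
    using nilpotent_ideal_le_jacobson_radical[OF nil] by blast
  then show ?thesis
    using semisimple nil by (simp add: semiprimary_def)
qed

end
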